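(* Let $\mathbf p=(p_1,\dots,p_r)$ and $\mathbf q=(q_1,\dots,q_r)$ be probability distributions on $\mathcal X=\{c_1,\dots,c_r\}$ with $p_j>0$ and $q_j>0$ for all $j\in D$, and let $\phi:[0,1]^2\to\mathbb R$ be a measurable function having continuous second order partial derivatives. Let $\widehat{\mathbf p}_n$ and $\widehat{\mathbf q}_m$ be the empirical distributions of i.i.d. samples $X_1,\dots,X_n$ from $\mathbf p$ and $Y_1,\dots,Y_m$ from $\mathbf q$. Then the following central limit theorems hold, where $\rightsquigarrow$ denotes convergence in distribution. (a) (One sample) As $n\to+\infty$, $$\sqrt n\,\bigl(J(\widehat{\mathbf p}_n,\mathbf q)-J(\mathbf p,\mathbf q)\bigr)\rightsquigarrow\mathcal N(0,V_{1,p}),$$ and as $m\to+\infty$, $$\sqrt m\,\bigl(J(\mathbf p,\widehat{\mathbf q}_m)-J(\mathbf p,\mathbf q)\bigr)\rightsquigarrow\mathcal N(0,V_{2,q}).$$ (b) (Two samples) For $(n,m)\to(+\infty,+\infty)$ and $nm/(n+m)\to\gamma\in(0,1)$, $$\left(\frac{nm}{mV_{1,p}+nV_{2,q}}\right)^{1/2}\bigl(J(\widehat{\mathbf p}_n,\widehat{\mathbf q}_m)-J(\mathbf p,\mathbf q)\bigr)\rightsquigarrow\mathcal N(0,1).$$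
   Context: $\mathcal X=\{c_1,\dots,c_r\}$ with $r\ge 2$ is a finite set and $D=\{1,\dots,r\}$. A probability distribution $\mathbf p$ on $\mathcal X$ is identified with the vector $(p_1,\dots,p_r)$, $p_j$ being the mass of $c_j$. $X_1,X_2,\dots$ are i.i.d. with $\mathbb P(X_i=c_j)=p_j$, and $Y_1,Y_2,\dots$ are i.i.d. with $\mathbb P(Y_i=c_j)=q_j$; the two samples are independent of each other. Empirical probabilities: $\widehat p_n^{c_j}=\frac1n\sum_{i=1}^n 1_{\{X_i=c_j\}}$, $\widehat q_m^{c_j}=\frac1m\sum_{i=1}^m 1_{\{Y_i=c_j\}}$, $\widehat{\mathbf p}_n=(\widehat p_n^{c_j})_{j\in D}$, $\widehat{\mathbf q}_m=(\widehat q_m^{c_j})_{j\in D}$. The $\phi$-divergence is $J(\mathbf p,\mathbf q)=\sum_{j\in D}\phi(p_j,q_j)$ for any probability distributions $\mathbf p,\mathbf q$ on $\mathcal X$. Write $\phi_1^{(1)}(s,t)=\frac{\partial\phi}{\partial s}(s,t)$, $\phi_2^{(1)}(s,t)=\frac{\partial\phi}{\partial t}(s,t)$, and $$V_{1,p}=\sum_{j\in D}p_j(1-p_j)\bigl(\phi_1^{(1)}(p_j,q_j)\bigr)^2-2\sum_{(i,j)\in D^2,\ i\neq j}p_ip_j\,\phi_1^{(1)}(p_i,q_i)\phi_1^{(1)}(p_j,q_j),$$ $$V_{2,q}=\sum_{j\in D}q_j(1-q_j)\bigl(\phi_2^{(1)}(p_j,q_j)\bigr)^2-2\sum_{(i,j)\in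 D^2,\ i\neq j}q_iq_j\,\phi_2^{(1)}(p_i,q_i)\phi_2^{(1)}(p_j,q_j).$$
   Formalization: In V_{1,p} and V_{2,q} each unordered pair i≠j is counted once (as printed they can be negative); in (b) the condition nm/(n+m)→γ, which can never hold, is supplemented by the alternative n/(n+m)→γ, and V_{1,p}, V_{2,q} are assumed not both zero. *)

theory Defs
  imports "HOL-Probability.Probability"
begin

definition prob_vector :: "nat \<Rightarrow> (nat \<Rightarrow> real) \<Rightarrow> bool" where
  "prob_vector r p \<longleftrightarrow> (\<forall>j\<in>{1..r}. 0 \<le> p j) \<and> (\<Sum>j=1..r. p j) = 1"

definition iid_sample ::
  "'w measure \<Rightarrow> nat \<Rightarrow> (nat \<Rightarrow> 'a) \<Rightarrow> (nat \<Rightarrow> real) \<Rightarrow> (nat \<Rightarrow> 'w \<Rightarrow> 'a) \<Rightarrow> bool" where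
  "iid_sample M r c p X \<longleftrightarrow>
     prob_space.indep_vars M (\<lambda>_. count_space (c ` {1..r})) X {1..} \<and>
     (\<forall>i\<ge>1. \<forall>j\<in>{1..r}. measure M {\<omega> \<in> space M. X i \<omega> = c j} = p j)"

text \<open>Independence of the two samples as whole sequences.\<close>

definition independent_samples ::
  "'w measure \<Rightarrow> 'a set \<Rightarrow> (nat \<Rightarrow> 'w \<Rightarrow> 'a) \<Rightarrow> (nat \<Rightarrow> 'w \<Rightarrow> 'a) \<Rightarrow> bool" where
  "independent_samples M A X Y \<longleftrightarrow>
     prob_space.indep_var M
       (Pi\<^sub>M {1..} (\<lambda>_. count_space A)) (\<lambda>\<omega>. \<lambda>i\<in>{1..}. X i \<omega>)
       (Pi\<^sub>M {1..} (\<lambda>_. count_space A)) (\<lambda>\<omega>. \<lambda>i\<in>{1..}. Y i \<omega>)"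

definition empirical ::
  "(nat \<Rightarrow> 'a) \<Rightarrow> (nat \<Rightarrow> 'w \<Rightarrow> 'a) \<Rightarrow> nat \<Rightarrow> 'w \<Rightarrow> nat \<Rightarrow> real" where
  "empirical c X n \<omega> j = (\<Sum>i=1..n. of_bool (X i \<omega> = c j)) / real n"

definition phi_divergence ::
  "nat \<Rightarrow> (real \<Rightarrow> real \<Rightarrow> real) \<Rightarrow> (nat \<Rightarrow> real) \<Rightarrow> (nat \<Rightarrow> real) \<Rightarrow> real" where
  "phi_divergence r \<phi> p q = (\<Sum>j=1..r. \<phi> (p j) (q j))"

definition partial1 :: "(real \<Rightarrow> real \<Rightarrow> real) \<Rightarrow> real \<Rightarrow> real \<Rightarrow> real" where
  "partial1 \<phi> s t = deriv (\<lambda>u. \<phi> u t) s"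

definition partial2 :: "(real \<Rightarrow> real \<Rightarrow> real) \<Rightarrow> real \<Rightarrow> real \<Rightarrow> real" where
  "partial2 \<phi> s t = deriv (\<lambda>u. \<phi> s u) t"

text \<open>
  The partial derivatives are required on the open square only, so that they are ordinary two-sided
  derivatives and do not depend on the values of the total function outside the closed unit square.
  Nothing is required at the boundary; thus functions such as \<open>s * ln (s / t)\<close> are admitted.
\<close>

definition has_partials :: "(real \<Rightarrow> real \<Rightarrow> real) \<Rightarrow> bool" where
  "has_partials \<psi> \<longleftrightarrow> (\<forall>s\<in>{0<..<1}. \<forall>t\<in>{0<..<1}.
     (\<lambda>u. \<psi> u t) field_differentiable at s \<and> (\<lambda>u. \<psi> s u) field_differentiable at t)"

definition continuous_second_partials :: "(real \<Rightarrow> real \<Rightarrow> real) \<Rightarrow> bool" where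
  "continuous_second_partials \<phi> \<longleftrightarrow>
     has_partials \<phi> \<and> has_partials (partial1 \<phi>) \<and> has_partials (partial2 \<phi>) \<and>
     (\<forall>\<psi> \<in> {partial1 (partial1 \<phi>), partial2 (partial1 \<phi>),
             partial1 (partial2 \<phi>), partial2 (partial2 \<phi>)}.
        continuous_on ({0<..<1} \<times> {0<..<1}) (\<lambda>(s, t). \<psi> s t))"

text \<open>
  The quantity \<open>multinomial_var r p a\<close> is the variance of \<open>a\<^sub>J\<close> when \<open>J\<close> has distribution \<open>p\<close>.
  In the cross term every unordered pair of distinct indices is counted once: with both orders
  counted under the factor 2 the expression would be negative already for nonzero constant \<open>a\<close>.
\<close>

definition multinomial_var :: "nat \<Rightarrow> (nat \<Rightarrow> real) \<Rightarrow> (nat \<Rightarrow> real) \<Rightarrow> real" where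
  "multinomial_var r p a =
     (\<Sum>j=1..r. p j * (1 - p j) * (a j)\<^sup>2)
     - 2 * (\<Sum>(i, j) | i \<in> {1..r} \<and> j \<in> {1..r} \<and> i < j. p i * p j * a i * a j)"

definition V1 ::
  "nat \<Rightarrow> (real \<Rightarrow> real \<Rightarrow> real) \<Rightarrow> (nat \<Rightarrow> real) \<Rightarrow> (nat \<Rightarrow> real) \<Rightarrow> real" where
  "V1 r \<phi> p q = multinomial_var r p (\<lambda>j. partial1 \<phi> (p j) (q j))"

definition V2 ::
  "nat \<Rightarrow> (real \<Rightarrow> real \<Rightarrow> real) \<Rightarrow> (nat \<Rightarrow> real) \<Rightarrow> (nat \<Rightarrow> real) \<Rightarrow> real" where
  "V2 r \<phi> p q = multinomial_var r q (\<lambda>j. partial2 \<phi> (p j) (q j))"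

text \<open>The second parameter is the variance; variance 0 gives the Dirac measure at the mean.\<close>

definition normal_law :: "real \<Rightarrow> real \<Rightarrow> real measure" where
  "normal_law \<mu> v =
     (if v = 0 then return borel \<mu> else density lborel (\<lambda>x. ennreal (normal_density \<mu> (sqrt v) x)))"

definition converges_in_law :: "'w measure \<Rightarrow> (nat \<Rightarrow> 'w \<Rightarrow> real) \<Rightarrow> real measure \<Rightarrow> bool" where
  "converges_in_law M Z L \<longleftrightarrow> weak_conv_m (\<lambda>n. distr M borel (Z n)) L"

text \<open>
  If \<open>N k\<close> and \<open>K k\<close> tend to infinity, then so does \<open>N k * K k / (N k + K k)\<close>, so the first
  alternative, the balance condition in its printed form, is then never met. The second alternative
  is the balance condition that has content: both sample proportions have limits strictly between
  0 and 1.
\<close>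

definition balanced_sizes :: "(nat \<Rightarrow> nat) \<Rightarrow> (nat \<Rightarrow> nat) \<Rightarrow> real \<Rightarrow> bool" where
  "balanced_sizes N K \<gamma> \<longleftrightarrow>
     (\<lambda>k. real (N k) * real (K k) / (real (N k) + real (K k))) \<longlonglongrightarrow> \<gamma> \<or>
     (\<lambda>k. real (N k) / (real (N k) + real (K k))) \<longlonglongrightarrow> \<gamma>"

end

theory Submission
  imports Defs
begin

text \<open>
  The delta method. Continuity of the second partial derivatives makes \<open>\<phi>\<close> Frechet differentiable
  at each interior point \<open>(p j, q j)\<close>, and by Chebyshev's inequality the rescaled deviations of the
  empirical frequencies are bounded in probability, so up to a term vanishing in probability the
  statistic is a linear functional of these deviations. That functional is the normalised centred sum
  of the iid variables \<open>a\<^sub>J\<close>, whose variance is \<open>multinomial_var\<close>, and the central limit theorem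
  applies to it (it is almost surely \<open>0\<close> if the variance is \<open>0\<close>). Slutsky's theorem and the two-sample
  case are handled with characteristic functions, which multiply for independent samples.
\<close>

subsection \<open>Differentiability from continuous partial derivatives\<close>

text \<open>An increment splits into a move in the first coordinate at fixed \<open>t\<close>, where
  differentiability at \<open>s\<close> suffices, and a move in the second coordinate at a nearby
  first coordinate. The latter needs the derivative to vary little, which is the continuity of
  \<open>partial2 \<psi>\<close>.\<close>

lemma has_derivative_of_continuous_partials:
  assumes "has_partials \<psi>"
    and cont: "continuous_on ({0<..<1} \<times> {0<..<1}) (\<lambda>(s, t). partial2 \<psi> s t)"
    and st: "s \<in> {0<..<1}" "t \<in> {0<..<1}"
  shows "((\<lambda>(s, t). \<psi> s t) has_derivative
           (\<lambda>(x, y). partial1 \<psi> s t * x + partial2 \<psi> s t * y)) (at (s, t))"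
proof -
  let ?I = "{0<..<1::real}"
  \<comment> \<open>The rule for joint differentiability takes the second partial derivative as a
    bounded linear map. Multiplication by a number depends boundedly and linearly on that number, so
    continuity carries over.\<close>
  let ?D = "\<lambda>s t. blinfun_mult_right (partial2 \<psi> s t)"
  have d1: "((\<lambda>x. \<psi> x t) has_derivative (\<lambda>x. partial1 \<psi> s t * x)) (at s within ?I)"
    using assms(1) st unfolding has_partials_def partial1_def
    by (metis DERIV_deriv_iff_field_differentiable has_field_derivative_def has_derivative_at_withinI)
  have d2: "((\<lambda>y. \<psi> x y) has_derivative blinfun_apply (?D x y)) (at y within ?I)"
    if "x \<in> ?I" "y \<in> ?I" for x y
    using assms(1) that unfolding has_partials_def partial2_def
    by simp
       (metis DERIV_deriv_iff_field_differentiable has_field_derivative_def has_derivative_at_withinI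
          greaterThanLessThan_iff)
  have "continuous (at (s, t) within ?I \<times> ?I) (\<lambda>(s, t). partial2 \<psi> s t)"
    using cont st by (auto simp: continuous_on_eq_continuous_within)
  then have c: "continuous (at (s, t) within ?I \<times> ?I) (\<lambda>(s, t). ?D s t)"
    unfolding split_beta'
    by (rule bounded_linear.continuous[OF bounded_linear_blinfun_mult_right])
  have "((\<lambda>(s, t). \<psi> s t) has_derivative
         (\<lambda>(x, y). partial1 \<psi> s t * x + blinfun_apply (?D s t) y)) (at (s, t) within ?I \<times> ?I)"
    by (rule has_derivative_partialsI[OF d1 d2 c]) (use st in auto)
  moreover have "at (s, t) within ?I \<times> ?I = at (s, t)"
    using st by (intro at_within_open open_Times) auto
  ultimately show ?thesis
    by simp
qed

text \<open>The preceding lemma is used twice: applied to \<open>partial2 \<phi>\<close> it makes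
  that function differentiable, hence continuous, on the open square, and this is the continuity
  required to apply it to \<open>\<phi>\<close>.\<close>

lemma has_derivative_of_continuous_second_partials:
  assumes \<phi>: "continuous_second_partials \<phi>"
    and st: "s \<in> {0<..<1}" "t \<in> {0<..<1}"
  shows "((\<lambda>(s, t). \<phi> s t) has_derivative
           (\<lambda>(x, y). partial1 \<phi> s t * x + partial2 \<phi> s t * y)) (at (s, t))"
proof (rule has_derivative_of_continuous_partials[OF _ _ st])
  show "has_partials \<phi>"
    using \<phi> by (simp add: continuous_second_partials_def)
  have "((\<lambda>(s, t). partial2 \<phi> s t) has_derivative
           (\<lambda>(x, y). partial1 (partial2 \<phi>) s t * x + partial2 (partial2 \<phi>) s t * y)) (at (s, t))"
    if "s \<in> {0<..<1}" "t \<in> {0<..<1}" for s t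
    using \<phi> that
    by (intro has_derivative_of_continuous_partials) (auto simp: continuous_second_partials_def)
  then show "continuous_on ({0<..<1} \<times> {0<..<1}) (\<lambda>(s, t). partial2 \<phi> s t)"
    by (intro continuous_at_imp_continuous_on ballI) (metis SigmaE has_derivative_continuous)
qed

subsection \<open>Convergence and boundedness in probability\<close>

definition vanishes_in_prob :: "'w measure \<Rightarrow> (nat \<Rightarrow> 'w \<Rightarrow> real) \<Rightarrow> bool" where
  "vanishes_in_prob M W \<longleftrightarrow>
     (\<forall>e>0. (\<lambda>n. measure M {\<omega> \<in> space M. e < \<bar>W n \<omega>\<bar>}) \<longlonglongrightarrow> 0)"

text \<open>Tightness, with one bound for all indices and not just for large ones; second moment
  bounds give it in this form. Values in a normed space allow pairs of deviations.\<close>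

definition bounded_in_prob :: "'w measure \<Rightarrow> (nat \<Rightarrow> 'w \<Rightarrow> 'b::real_normed_vector) \<Rightarrow> bool" where
  "bounded_in_prob M U \<longleftrightarrow>
     (\<forall>d>0. \<exists>B>0. \<forall>n. measure M {\<omega> \<in> space M. B < norm (U n \<omega>)} \<le> d)"

context prob_space
begin

lemma vanishes_in_probI:
  assumes "\<And>e d. e > 0 \<Longrightarrow> d > 0 \<Longrightarrow> \<forall>\<^sub>F n in sequentially. prob {\<omega> \<in> space M. e < \<bar>W n \<omega>\<bar>} \<le> d"
  shows "vanishes_in_prob M W"
  unfolding vanishes_in_prob_def
proof (intro allI impI tendstoI)
  fix e d :: real assume "e > 0" "d > 0"
  then show "\<forall>\<^sub>F n in sequentially. dist (prob {\<omega> \<in> space M. e < \<bar>W n \<omega>\<bar>}) 0 < d"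
    using assms[of e "d / 2"] by (auto elim!: eventually_mono)
qed

lemma vanishes_in_probD:
  assumes "vanishes_in_prob M W" "e > 0" "d > 0"
  shows "\<forall>\<^sub>F n in sequentially. prob {\<omega> \<in> space M. e < \<bar>W n \<omega>\<bar>} \<le> d"
proof -
  have "\<forall>\<^sub>F n in sequentially. prob {\<omega> \<in> space M. e < \<bar>W n \<omega>\<bar>} < d"
    using assms order_tendstoD(2) unfolding vanishes_in_prob_def by blast
  then show ?thesis by eventually_elim simp
qed

lemma vanishes_in_prob_add:
  assumes V: "vanishes_in_prob M V" and W: "vanishes_in_prob M W"
    and [measurable]: "\<And>n. V n \<in> borel_measurable M" "\<And>n. W n \<in> borel_measurable M"
  shows "vanishes_in_prob M (\<lambda>n \<omega>. V n \<omega> + W n \<omega>)"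
proof (rule vanishes_in_probI)
  fix e d :: real assume e: "e > 0" "d > 0"
  have "e/2 > 0" "d/2 > 0" using e by auto
  from vanishes_in_probD[OF V this] vanishes_in_probD[OF W this]
  show "\<forall>\<^sub>F n in sequentially. prob {\<omega> \<in> space M. e < \<bar>V n \<omega> + W n \<omega>\<bar>} \<le> d"
  proof eventually_elim
    case (elim n)
    have "prob {\<omega> \<in> space M. e < \<bar>V n \<omega> + W n \<omega>\<bar>} \<le>
      prob ({\<omega> \<in> space M. e/2 < \<bar>V n \<omega>\<bar>} \<union> {\<omega> \<in> space M. e/2 < \<bar>W n \<omega>\<bar>})"
      by (intro finite_measure_mono) auto
    also have "\<dots> \<le> prob {\<omega> \<in> space M. e/2 < \<bar>V n \<omega>\<bar>} + prob {\<omega> \<in> space M. e/2 < \<bar>W n \<omega>\<bar>}"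
      by (intro measure_Un_le) auto
    finally show ?case using elim by simp
  qed
qed

lemma vanishes_in_prob_sum:
  assumes "finite I" "\<And>i. i \<in> I \<Longrightarrow> vanishes_in_prob M (W i)"
    and "\<And>i n. i \<in> I \<Longrightarrow> W i n \<in> borel_measurable M"
  shows "vanishes_in_prob M (\<lambda>n \<omega>. \<Sum>i\<in>I. W i n \<omega>)"
  using assms
proof (induction I)
  case empty
  then show ?case by (simp add: vanishes_in_prob_def)
next
  case (insert i I)
  then show ?case
    by (auto intro!: vanishes_in_prob_add)
qed

text \<open>The rule o(1) * O_P(1) = o_P(1) for deterministic coefficients. In the two-sample case
  it replaces weights depending on the sample sizes by their limits.\<close>

lemma vanishes_in_prob_coeff:
  assumes U: "bounded_in_prob M U" and a: "a \<longlonglongrightarrow> 0"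
    and [measurable]: "\<And>n. U n \<in> borel_measurable M"
  shows "vanishes_in_prob M (\<lambda>n \<omega>. a n * U n \<omega>)"
proof (rule vanishes_in_probI)
  fix e d :: real assume e: "e > 0" "d > 0"
  from U \<open>d > 0\<close> obtain B where B: "B > 0" "\<And>n. prob {\<omega> \<in> space M. B < norm (U n \<omega>)} \<le> d"
    unfolding bounded_in_prob_def by blast
  have "\<forall>\<^sub>F n in sequentially. \<bar>a n\<bar> < e / B"
    using a e B tendstoD[of a 0 sequentially "e / B"] by simp
  then show "\<forall>\<^sub>F n in sequentially. prob {\<omega> \<in> space M. e < \<bar>a n * U n \<omega>\<bar>} \<le> d"
  proof eventually_elim
    case (elim n)
    have "prob {\<omega> \<in> space M. e < \<bar>a n * U n \<omega>\<bar>} \<le> prob {\<omega> \<in> space M. B < norm (U n \<omega>)}"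
    proof (intro finite_measure_mono subsetI)
      fix \<omega> assume *: "\<omega> \<in> {\<omega> \<in> space M. e < \<bar>a n * U n \<omega>\<bar>}"
      have "\<bar>U n \<omega>\<bar> > B"
      proof (rule ccontr)
        assume "\<not> \<bar>U n \<omega>\<bar> > B"
        then have "\<bar>a n\<bar> * \<bar>U n \<omega>\<bar> \<le> e / B * B"
          using elim B e by (intro mult_mono) auto
        with * B show False by (auto simp: abs_mult)
      qed
      with * show "\<omega> \<in> {\<omega> \<in> space M. B < norm (U n \<omega>)}" by auto
    qed auto
    with B(2)[of n] show ?case by linarith
  qed
qed

lemma bounded_in_prob_const_mult:
  fixes U :: "nat \<Rightarrow> 'a \<Rightarrow> real"
  assumes U: "bounded_in_prob M U" and a: "\<And>n. \<bar>a n\<bar> \<le> C"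
    and [measurable]: "\<And>n. U n \<in> borel_measurable M"
  shows "bounded_in_prob M (\<lambda>n \<omega>. a n * U n \<omega>)"
  unfolding bounded_in_prob_def
proof (intro allI impI)
  fix d :: real assume "d > 0"
  with U obtain B where B: "B > 0" "\<And>n. prob {\<omega> \<in> space M. B < norm (U n \<omega>)} \<le> d"
    unfolding bounded_in_prob_def by blast
  have C: "C \<ge> 0" using a[of 0] by linarith
  \<comment> \<open>\<open>C\<close> may be 0; the added 1 keeps the new bound positive.\<close>
  have "prob {\<omega> \<in> space M. (C + 1) * B < norm (a n * U n \<omega>)} \<le> d" for n
  proof -
    have "prob {\<omega> \<in> space M. (C + 1) * B < norm (a n * U n \<omega>)} \<le>
        prob {\<omega> \<in> space M. B < norm (U n \<omega>)}"
    proof (intro finite_measure_mono subsetI)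
      fix \<omega> assume *: "\<omega> \<in> {\<omega> \<in> space M. (C + 1) * B < norm (a n * U n \<omega>)}"
      have "\<bar>U n \<omega>\<bar> > B"
      proof (rule ccontr)
        assume "\<not> \<bar>U n \<omega>\<bar> > B"
        then have "\<bar>a n\<bar> * \<bar>U n \<omega>\<bar> \<le> (C + 1) * B"
          using a[of n] B C by (intro mult_mono) auto
        with * B show False by (auto simp: abs_mult)
      qed
      with * show "\<omega> \<in> {\<omega> \<in> space M. B < norm (U n \<omega>)}" by auto
    qed auto
    with B(2)[of n] show ?thesis by linarith
  qed
  then show "\<exists>B>0. \<forall>n. prob {\<omega> \<in> space M. B < norm (a n * U n \<omega>)} \<le> d"
    using B C by (intro exI[of _ "(C + 1) * B"]) auto
qed

lemma bounded_in_prob_Pair: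
  fixes U V :: "nat \<Rightarrow> 'a \<Rightarrow> real"
  assumes U: "bounded_in_prob M U" and V: "bounded_in_prob M V"
    and [measurable]: "\<And>n. U n \<in> borel_measurable M" "\<And>n. V n \<in> borel_measurable M"
  shows "bounded_in_prob M (\<lambda>n \<omega>. (U n \<omega>, V n \<omega>))"
  unfolding bounded_in_prob_def
proof (intro allI impI)
  fix d :: real assume "d > 0"
  then have "d / 2 > 0" by simp
  with U obtain B where B: "B > 0" "\<And>n. prob {\<omega> \<in> space M. B < norm (U n \<omega>)} \<le> d / 2"
    unfolding bounded_in_prob_def by blast
  from V \<open>d / 2 > 0\<close> obtain C where C: "C > 0" "\<And>n. prob {\<omega> \<in> space M. C < norm (V n \<omega>)} \<le> d / 2"
    unfolding bounded_in_prob_def by blast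
  have "prob {\<omega> \<in> space M. B + C < norm (U n \<omega>, V n \<omega>)} \<le> d" for n
  proof -
    have "norm (U n \<omega>, V n \<omega>) \<le> \<bar>U n \<omega>\<bar> + \<bar>V n \<omega>\<bar>" for \<omega>
      using norm_Pair_le[of "U n \<omega>" "V n \<omega>"] by simp
    then have "B < norm (U n \<omega>) \<or> C < norm (V n \<omega>)" if "B + C < norm (U n \<omega>, V n \<omega>)" for \<omega>
      using that by (smt (verit) real_norm_def)
    then have "prob {\<omega> \<in> space M. B + C < norm (U n \<omega>, V n \<omega>)} \<le>
      prob ({\<omega> \<in> space M. B < norm (U n \<omega>)} \<union> {\<omega> \<in> space M. C < norm (V n \<omega>)})"
      by (intro finite_measure_mono subsetI) (auto, measurable)
    also have "\<dots> \<le> prob {\<omega> \<in> space M. B < norm (U n \<omega>)} + prob {\<omega> \<in> space M. C < norm (V n \<omega>)}"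
      by (intro measure_Un_le) auto
    finally show ?thesis using B(2)[of n] C(2)[of n] by simp
  qed
  then show "\<exists>B>0. \<forall>n. prob {\<omega> \<in> space M. B < norm (U n \<omega>, V n \<omega>)} \<le> d"
    using B C by (intro exI[of _ "B + C"]) auto
qed

lemma bounded_in_prob_second_moment:
  fixes U :: "nat \<Rightarrow> 'a \<Rightarrow> real"
  assumes [measurable]: "\<And>n. U n \<in> borel_measurable M"
    and int: "\<And>n. integrable M (\<lambda>\<omega>. (U n \<omega>)\<^sup>2)"
    and le: "\<And>n. expectation (\<lambda>\<omega>. (U n \<omega>)\<^sup>2) \<le> C"
  shows "bounded_in_prob M U"
  unfolding bounded_in_prob_def
proof (intro allI impI)
  fix d :: real assume d: "d > 0"
  have "C \<ge> 0"
    by (rule order_trans[OF _ le[of 0]]) simp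
  \<comment> \<open>Chosen so that Chebyshev's bound \<open>(C + 1) / B\<^sup>2\<close> equals
    \<open>d\<close>; the added 1 makes \<open>B\<close> positive even for
    \<open>C = 0\<close>.\<close>
  define B where "B = sqrt ((C + 1) / d)"
  have B: "B > 0" "B\<^sup>2 = (C + 1) / d"
    using d \<open>C \<ge> 0\<close> by (auto simp: B_def)
  have "prob {\<omega> \<in> space M. B < norm (U n \<omega>)} \<le> d" for n
  proof -
    have "prob {\<omega> \<in> space M. B < norm (U n \<omega>)} \<le> prob {\<omega> \<in> space M. \<bar>U n \<omega>\<bar> \<ge> B}"
      by (intro finite_measure_mono) auto
    also have "\<dots> \<le> expectation (\<lambda>\<omega>. (U n \<omega>)\<^sup>2) / B\<^sup>2"
      using int B by (intro second_moment_method) auto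
    also have "\<dots> \<le> (C + 1) / B\<^sup>2"
      using le[of n] by (intro divide_right_mono) auto
    also have "\<dots> = d" using d \<open>C \<ge> 0\<close> by (simp add: B(2))
    finally show ?thesis .
  qed
  with B show "\<exists>B>0. \<forall>n. prob {\<omega> \<in> space M. B < norm (U n \<omega>)} \<le> d" by blast
qed

text \<open>Up to probability \<open>d\<close>, \<open>Z n\<close> is within \<open>B / s n\<close>
  of \<open>z\<close>. For large \<open>n\<close> this lies in the neighbourhood where the remainder
  is at most \<open>e / B\<close> times the distance, so the remainder multiplied by
  \<open>s n\<close> is at most \<open>e\<close>.\<close>

lemma vanishes_in_prob_remainder:
  fixes f :: "'b::euclidean_space \<Rightarrow> real"
  assumes f: "(f has_derivative D) (at z)"
    and s: "filterlim s at_top sequentially"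
    and [measurable]: "\<And>n. Z n \<in> borel_measurable M"
    and bdd: "bounded_in_prob M (\<lambda>n \<omega>. s n *\<^sub>R (Z n \<omega> - z))"
  shows "vanishes_in_prob M (\<lambda>n \<omega>. s n * (f (Z n \<omega>) - f z - D (Z n \<omega> - z)))"
proof (rule vanishes_in_probI)
  fix e d :: real assume e: "e > 0" "d > 0"
  from bdd \<open>d > 0\<close> obtain B
    where B: "B > 0" "\<And>n. prob {\<omega> \<in> space M. B < norm (s n *\<^sub>R (Z n \<omega> - z))} \<le> d"
    unfolding bounded_in_prob_def by blast
  have "e / B > 0" using e B by simp
  then obtain \<delta> where \<delta>: "\<delta> > 0"
    "\<And>y. norm (y - z) < \<delta> \<Longrightarrow> \<bar>f y - f z - D (y - z)\<bar> \<le> e / B * norm (y - z)"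
    using f unfolding has_derivative_at_alt real_norm_def by blast
  have "\<forall>\<^sub>F n in sequentially. s n > max 0 (B / \<delta>)"
    using s unfolding filterlim_at_top_dense by blast
  then show "\<forall>\<^sub>F n in sequentially.
      prob {\<omega> \<in> space M. e < \<bar>s n * (f (Z n \<omega>) - f z - D (Z n \<omega> - z))\<bar>} \<le> d"
  proof eventually_elim
    case (elim n)
    \<comment> \<open>Monotonicity asks for measurability of the larger event only, and that event
      does not involve \<open>f\<close>.\<close>
    have "prob {\<omega> \<in> space M. e < \<bar>s n * (f (Z n \<omega>) - f z - D (Z n \<omega> - z))\<bar>}
      \<le> prob {\<omega> \<in> space M. B < norm (s n *\<^sub>R (Z n \<omega> - z))}"
    proof (intro finite_measure_mono subsetI)
      fix \<omega> assume *: "\<omega> \<in> {\<omega> \<in> space M. e < \<bar>s n * (f (Z n \<omega>) - f z - D (Z n \<omega> - z))\<bar>}"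
      have "B < s n * norm (Z n \<omega> - z)"
      proof (rule ccontr)
        assume "\<not> B < s n * norm (Z n \<omega> - z)"
        then have le: "s n * norm (Z n \<omega> - z) \<le> B" by simp
        moreover have "s n > 0" "B < s n * \<delta>"
          using elim \<delta> by (auto simp: field_simps)
        ultimately have "norm (Z n \<omega> - z) < \<delta>"
          by (meson le_less_trans mult_less_cancel_left_pos)
        then have "s n * \<bar>f (Z n \<omega>) - f z - D (Z n \<omega> - z)\<bar> \<le> s n * (e / B * norm (Z n \<omega> - z))"
          using \<delta>(2) \<open>s n > 0\<close> by (intro mult_left_mono) auto
        also have "\<dots> = e / B * (s n * norm (Z n \<omega> - z))" by simp
        also have "\<dots> \<le> e / B * B"
          using le e B by (intro mult_left_mono) auto
        finally show False
          using * \<open>s n > 0\<close> B by (auto simp: abs_mult)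
      qed
      with * elim show "\<omega> \<in> {\<omega> \<in> space M. B < norm (s n *\<^sub>R (Z n \<omega> - z))}" by auto
    qed measurable
    with B(2)[of n] show ?case by linarith
  qed
qed

text \<open>The two integrands differ by \<open>iexp (t * W \<omega>) - 1\<close> up to a factor of
  modulus 1. Its modulus is at most \<open>\<bar>t * W \<omega>\<bar>\<close>, used where
  \<open>W\<close> is small, and at most 2, used on the exceptional event.\<close>

lemma char_diff_le:
  assumes [measurable]: "Z \<in> borel_measurable M" "W \<in> borel_measurable M" and e: "e > 0"
  shows "cmod (char (distr M borel (\<lambda>\<omega>. Z \<omega> + W \<omega>)) t - char (distr M borel Z) t)
           \<le> \<bar>t\<bar> * e + 2 * prob {\<omega> \<in> space M. e < \<bar>W \<omega>\<bar>}"
proof -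
  let ?A = "{\<omega> \<in> space M. e < \<bar>W \<omega>\<bar>}"
  have int: "complex_integrable M (\<lambda>\<omega>. iexp (t * U \<omega>))" if "U \<in> borel_measurable M" for U
    using that by (intro integrable_iexp) auto
  have pt: "cmod (iexp (t * (Z \<omega> + W \<omega>)) - iexp (t * Z \<omega>)) \<le> \<bar>t\<bar> * e + 2 * indicator ?A \<omega>"
    if "\<omega> \<in> space M" for \<omega>
  proof -
    have "iexp (t * (Z \<omega> + W \<omega>)) - iexp (t * Z \<omega>) = iexp (t * Z \<omega>) * (iexp (t * W \<omega>) - 1)"
      by (simp add: algebra_simps exp_add)
    then have eq: "cmod (iexp (t * (Z \<omega> + W \<omega>)) - iexp (t * Z \<omega>)) = cmod (iexp (t * W \<omega>) - 1)"
      by (simp add: norm_mult)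
    have 1: "cmod (iexp (t * W \<omega>) - 1) \<le> \<bar>t * W \<omega>\<bar>" and 2: "cmod (iexp (t * W \<omega>) - 1) \<le> 2"
      using iexp_approx1[of "t * W \<omega>" 0] iexp_approx2[of "t * W \<omega>" 0] by simp_all
    show ?thesis
    proof (cases "\<omega> \<in> ?A")
      case True
      with e have "0 \<le> \<bar>t\<bar> * e" "indicator ?A \<omega> = (1::real)" by auto
      with 2 eq show ?thesis by linarith
    next
      case False
      then have "\<bar>t\<bar> * \<bar>W \<omega>\<bar> \<le> \<bar>t\<bar> * e"
        using that by (intro mult_left_mono) auto
      moreover have "indicator ?A \<omega> = (0::real)" using False by simp
      ultimately show ?thesis using 1 eq abs_mult[of t "W \<omega>"] by linarith
    qed
  qed
  have "char (distr M borel (\<lambda>\<omega>. Z \<omega> + W \<omega>)) t - char (distr M borel Z) t =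
      (CLINT \<omega>|M. iexp (t * (Z \<omega> + W \<omega>)) - iexp (t * Z \<omega>))"
    using int[of Z] int[of "\<lambda>\<omega>. Z \<omega> + W \<omega>"]
    by (subst Bochner_Integration.integral_diff) (auto simp: char_def integral_distr)
  then have "cmod (char (distr M borel (\<lambda>\<omega>. Z \<omega> + W \<omega>)) t - char (distr M borel Z) t)
      \<le> expectation (\<lambda>\<omega>. cmod (iexp (t * (Z \<omega> + W \<omega>)) - iexp (t * Z \<omega>)))"
    by (simp only: integral_norm_bound)
  also have "\<dots> \<le> expectation (\<lambda>\<omega>. \<bar>t\<bar> * e + 2 * indicator ?A \<omega>)"
  proof (rule integral_mono)
    show "integrable M (\<lambda>\<omega>. cmod (iexp (t * (Z \<omega> + W \<omega>)) - iexp (t * Z \<omega>)))"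
      by (intro integrable_norm Bochner_Integration.integrable_diff int) auto
    show "integrable M (\<lambda>\<omega>. \<bar>t\<bar> * e + 2 * indicator ?A \<omega>)"
      by (auto simp: emeasure_eq_measure)
  qed (rule pt)
  also have "\<dots> = \<bar>t\<bar> * e + 2 * prob ?A"
    by (simp add: emeasure_eq_measure prob_space)
  finally show ?thesis .
qed

text \<open>By the preceding bound the perturbation does not change the limit of the characteristic
  functions, and Levy's continuity theorem turns this limit into convergence in law.\<close>

lemma converges_in_law_slutsky:
  assumes Z [measurable]: "\<And>n. Z n \<in> borel_measurable M"
    and W [measurable]: "\<And>n. W n \<in> borel_measurable M"
    and L: "real_distribution L"
    and lim: "\<And>t. (\<lambda>n. char (distr M borel (Z n)) t) \<longlonglongrightarrow> char L t"
    and van: "vanishes_in_prob M W"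
  shows "converges_in_law M (\<lambda>n \<omega>. Z n \<omega> + W n \<omega>) L"
  unfolding converges_in_law_def
proof (rule levy_continuity[OF _ L])
  show "real_distribution (distr M borel (\<lambda>\<omega>. Z n \<omega> + W n \<omega>))" for n
    by (intro real_distribution_distr) auto
  fix t
  have "(\<lambda>n. char (distr M borel (\<lambda>\<omega>. Z n \<omega> + W n \<omega>)) t - char (distr M borel (Z n)) t) \<longlonglongrightarrow> 0"
  proof (rule tendstoI)
    fix d :: real assume d: "d > 0"
    \<comment> \<open>Half of \<open>d\<close> is spent on \<open>\<bar>t\<bar> * e\<close>, the
      other half on twice a probability of at most \<open>d / 4\<close>. The added 1 covers
      \<open>t = 0\<close>.\<close>
    define e where "e = d / (2 * (\<bar>t\<bar> + 1))"
    have e: "e > 0" "\<bar>t\<bar> * e < d / 2"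
      using d by (auto simp: e_def field_simps)
    have "\<forall>\<^sub>F n in sequentially. prob {\<omega> \<in> space M. e < \<bar>W n \<omega>\<bar>} \<le> d / 4"
      using van e d by (intro vanishes_in_probD) auto
    then show "\<forall>\<^sub>F n in sequentially. dist
        (char (distr M borel (\<lambda>\<omega>. Z n \<omega> + W n \<omega>)) t - char (distr M borel (Z n)) t) 0 < d"
    proof eventually_elim
      case (elim n)
      with char_diff_le[OF Z W e(1), of n n t] e show ?case by (simp add: dist_norm)
    qed
  qed
  from tendsto_add[OF this lim[of t]]
  show "(\<lambda>n. char (distr M borel (\<lambda>\<omega>. Z n \<omega> + W n \<omega>)) t) \<longlonglongrightarrow> char L t"
    by simp
qed

end

subsection \<open>Normal laws\<close>

text \<open>Scaling a standard normal variable covers both branches of \<open>normal_law\<close>: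
  for \<open>v = 0\<close> the scaled variable is constantly 0 and its law is the Dirac measure. The
  characteristic function then needs no case distinction.\<close>

lemma normal_law_eq_distr:
  assumes "v \<ge> 0"
  shows "normal_law 0 v = distr std_normal_distribution borel (\<lambda>x. sqrt v * x)"
proof (cases "v = 0")
  case True
  interpret prob_space std_normal_distribution
    by (rule prob_space_normal_density) simp
  show ?thesis
    using True distr_const[of 0 borel] by (simp add: normal_law_def)
next
  case False
  with assms have v: "v > 0" by simp
  interpret prob_space std_normal_distribution
    by (rule prob_space_normal_density) simp
  have "distributed std_normal_distribution lborel (\<lambda>x. x) std_normal_density"
    by (simp add: distributed_def distr_id2)
  from normal_density_affine[OF this, of "sqrt v" 0] v
  have "distr std_normal_distribution lborel (\<lambda>x. sqrt v * x) = density lborel (normal_density 0 (sqrt v))"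
    by (simp add: distributed_def)
  moreover have "distr std_normal_distribution lborel (\<lambda>x. sqrt v * x) =
      distr std_normal_distribution borel (\<lambda>x. sqrt v * x)"
    by (rule distr_cong) auto
  ultimately show ?thesis using v by (simp add: normal_law_def)
qed

lemma real_distribution_normal_law: "v \<ge> 0 \<Longrightarrow> real_distribution (normal_law 0 v)"
  by (subst normal_law_eq_distr)
     (auto intro!: prob_space.real_distribution_distr prob_space_normal_density)

lemma char_distr_scale:
  assumes [measurable]: "U \<in> borel_measurable M"
  shows "char (distr M borel (\<lambda>\<omega>. a * U \<omega>)) t = char (distr M borel U) (a * t)"
  by (simp add: char_def integral_distr mult_ac)

lemma char_normal_law:
  assumes "v \<ge> 0"
  shows "char (normal_law 0 v) t = complex_of_real (exp (- (v * t\<^sup>2) / 2))"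
proof -
  have "distr std_normal_distribution borel (\<lambda>x. x) = std_normal_distribution"
    by (simp add: distr_id2)
  then show ?thesis
    using assms char_distr_scale[of "\<lambda>x. x" std_normal_distribution "sqrt v" t]
    by (simp add: normal_law_eq_distr char_std_normal_distribution power_mult_distrib)
qed

subsection \<open>Linear statistics of an iid sample\<close>

text \<open>The squared mean is a sum over all index pairs. The pairs below and above the diagonal
  contribute equally, which yields the factor 2, and the diagonal accounts for the factor
  \<open>1 - p j\<close>.\<close>

lemma multinomial_var_eq:
  "multinomial_var r p a = (\<Sum>j=1..r. p j * (a j)\<^sup>2) - (\<Sum>j=1..r. p j * a j)\<^sup>2"
proof -
  let ?b = "\<lambda>j. p j * a j"
  let ?L = "{(i, j). i \<in> {1..r} \<and> j \<in> {1..r} \<and> i < j}"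
  let ?G = "{(i, j). i \<in> {1..r} \<and> j \<in> {1..r} \<and> j < i}"
  let ?E = "{(i, j). i \<in> {1..r} \<and> j \<in> {1..r} \<and> i = j}"
  let ?g = "\<lambda>(i, j). ?b i * ?b j"
  have fin: "finite ?L" "finite ?G" "finite ?E"
    by (auto intro: finite_subset[of _ "{1..r} \<times> {1..r}"])
  have "(\<Sum>j=1..r. ?b j)\<^sup>2 = sum ?g ({1..r} \<times> {1..r})"
    by (simp add: power2_eq_square sum_product sum.cartesian_product)
  also have "{1..r} \<times> {1..r} = ?E \<union> (?L \<union> ?G)" by auto
  also have "sum ?g \<dots> = sum ?g ?E + (sum ?g ?L + sum ?g ?G)"
    by (subst sum.union_disjoint; (subst sum.union_disjoint)?) (use fin in auto)
  also have "sum ?g ?G = sum ?g ?L"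
    by (rule sum.reindex_bij_witness[of _ prod.swap prod.swap]) auto
  also have "sum ?g ?E = (\<Sum>j=1..r. (?b j)\<^sup>2)"
    by (rule sum.reindex_bij_witness[of _ "\<lambda>j. (j, j)" fst]) (auto simp: power2_eq_square)
  also have "sum ?g ?L = (\<Sum>(i, j) | i \<in> {1..r} \<and> j \<in> {1..r} \<and> i < j. p i * p j * a i * a j)"
    by (intro sum.cong) (auto simp: mult_ac)
  finally show ?thesis
    unfolding multinomial_var_def
    by (simp add: algebra_simps sum_subtractf power2_eq_square)
qed

text \<open>With a partial derivative of \<open>\<phi>\<close> at the points
  \<open>(p j, q j)\<close> as \<open>a\<close>, this is the contribution of one sample to the
  first-order expansion of the scaled divergence.\<close>

definition linear_stat ::
  "nat \<Rightarrow> (nat \<Rightarrow> 'a) \<Rightarrow> (nat \<Rightarrow> real) \<Rightarrow> (nat \<Rightarrow> real) \<Rightarrow> (nat \<Rightarrow> 'w \<Rightarrow> 'a) \<Rightarrow> nat \<Rightarrow> 'w \<Rightarrow> real" where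
  "linear_stat r c p a X n \<omega> = (\<Sum>j=1..r. a j * (sqrt (real n) * (empirical c X n \<omega> j - p j)))"

lemma measurable_empirical:
  assumes "\<And>i. i \<ge> 1 \<Longrightarrow> X i \<in> measurable M (count_space A)"
  shows "(\<lambda>\<omega>. empirical c X n \<omega> j) \<in> borel_measurable M"
proof -
  have [measurable]: "(\<lambda>\<omega>. of_bool (X i \<omega> = c j) :: real) \<in> borel_measurable M" if "i \<in> {1..n}" for i
    using measurable_compose[OF assms[of i], of "\<lambda>x. of_bool (x = c j) :: real" borel] that by simp
  show ?thesis unfolding empirical_def by measurable
qed

lemma measurable_linear_stat:
  assumes "\<And>i. i \<ge> 1 \<Longrightarrow> X i \<in> measurable M (count_space A)"
  shows "linear_stat r c p a X n \<in> borel_measurable M"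
proof -
  note [measurable] = measurable_empirical[OF assms]
  show ?thesis unfolding linear_stat_def by measurable
qed

text \<open>Keeps the frequencies in the closed interval, so that \<open>\<phi>\<close> is evaluated
  only where it is known to be measurable. For \<open>n = 0\<close> the frequency is
  \<open>0 / 0 = 0\<close>.\<close>

lemma empirical_bounds: "0 \<le> empirical c X n \<omega> j" "empirical c X n \<omega> j \<le> 1"
proof -
  have "(\<Sum>i=1..n. of_bool (X i \<omega> = c j) :: real) \<le> real (card {1..n}) * 1"
    by (intro sum_bounded_above) auto
  then show "empirical c X n \<omega> j \<le> 1"
    by (cases "n = 0") (auto simp: empirical_def field_simps)
qed (auto simp: empirical_def intro!: divide_nonneg_nonneg sum_nonneg)

section \<open>A single iid sample: moments, tightness and central limit theorem\<close>

locale iid_sample_space = prob_space M for M :: "'w measure" +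
  fixes r :: nat and c :: "nat \<Rightarrow> 'a" and p :: "nat \<Rightarrow> real" and X :: "nat \<Rightarrow> 'w \<Rightarrow> 'a"
  assumes inj: "inj_on c {1..r}"
    and iid: "iid_sample M r c p X"
begin

lemma sample_measurable: "i \<ge> 1 \<Longrightarrow> X i \<in> measurable M (count_space (c ` {1..r}))"
  using iid unfolding iid_sample_def indep_vars_def by auto

lemmas empirical_measurable [measurable] = measurable_empirical[OF sample_measurable]
lemmas linear_stat_measurable [measurable] = measurable_linear_stat[OF sample_measurable]

text \<open>A sum of indicators avoids inverting \<open>c\<close> and turns into a combination of
  empirical frequencies when summed over the sample.\<close>

definition score :: "(nat \<Rightarrow> real) \<Rightarrow> 'a \<Rightarrow> real" where
  "score a x = (\<Sum>j=1..r. a j * of_bool (x = c j))"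

lemma score_apply: "j \<in> {1..r} \<Longrightarrow> score a (c j) = a j"
proof -
  assume j: "j \<in> {1..r}"
  have "score a (c j) = (\<Sum>i=1..r. if i = j then a i else 0)"
    unfolding score_def using inj j by (intro sum.cong) (auto simp: inj_on_eq_iff)
  then show ?thesis using j by simp
qed

lemma score_measurable: "i \<ge> 1 \<Longrightarrow> (\<lambda>\<omega>. score a (X i \<omega>)) \<in> borel_measurable M"
  by (rule measurable_compose[OF sample_measurable]) auto

lemma score_bound: "\<bar>score a x\<bar> \<le> (\<Sum>j=1..r. \<bar>a j\<bar>)"
  unfolding score_def by (rule order_trans[OF sum_abs]) (auto intro!: sum_mono simp: abs_mult simp del: sum_mult_of_bool_eq)

lemma integrable_score: "i \<ge> 1 \<Longrightarrow> integrable M (\<lambda>\<omega>. score a (X i \<omega>))"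
  using score_bound score_measurable
  by (intro integrable_const_bound[where B = "\<Sum>j=1..r. \<bar>a j\<bar>"] AE_I2) auto

lemma expectation_score:
  assumes "i \<ge> 1"
  shows "expectation (\<lambda>\<omega>. score a (X i \<omega>)) = (\<Sum>j=1..r. p j * a j)"
proof -
  have *: "{\<omega> \<in> space M. X i \<omega> = c j} \<in> sets M" if "j \<in> {1..r}" for j
    using measurable_sets[OF sample_measurable[OF assms], of "{c j}"] that
    by (simp add: vimage_def Int_def conj_commute)
  have "expectation (\<lambda>\<omega>. score a (X i \<omega>)) =
      expectation (\<lambda>\<omega>. \<Sum>j=1..r. a j * indicator {\<omega> \<in> space M. X i \<omega> = c j} \<omega>)" (is "_ = expectation ?f")
    unfolding score_def
    by (intro Bochner_Integration.integral_cong sum.cong refl) (auto simp: indicator_def)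
  also have "\<dots> = (\<Sum>j=1..r. a j * prob {\<omega> \<in> space M. X i \<omega> = c j})"
    using * by (subst Bochner_Integration.integral_sum) (auto simp: emeasure_eq_measure Int_absorb2)
  also have "\<dots> = (\<Sum>j=1..r. p j * a j)"
    using iid assms unfolding iid_sample_def by (intro sum.cong) auto
  finally show ?thesis .
qed

text \<open>A sample value is some \<open>c j\<close>, where the score is \<open>a j\<close>, so
  squaring acts on the coefficients. Second moments thereby reduce to first moments.\<close>

lemma score_square:
  assumes "i \<ge> 1" "\<omega> \<in> space M"
  shows "(score a (X i \<omega>))\<^sup>2 = score (\<lambda>j. (a j)\<^sup>2) (X i \<omega>)"
  using measurable_space[OF sample_measurable[OF assms(1)] assms(2)] by (auto simp: score_apply)

lemma score_variance:
  assumes "i \<ge> 1"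
  shows "integrable M (\<lambda>\<omega>. (score a (X i \<omega>))\<^sup>2)"
    and "variance (\<lambda>\<omega>. score a (X i \<omega>)) = multinomial_var r p a"
proof -
  show i: "integrable M (\<lambda>\<omega>. (score a (X i \<omega>))\<^sup>2)"
    using integrable_score[OF assms, of "\<lambda>j. (a j)\<^sup>2"]
    by (subst Bochner_Integration.integrable_cong[OF refl score_square[OF assms]]) auto
  have "expectation (\<lambda>\<omega>. (score a (X i \<omega>))\<^sup>2) = (\<Sum>j=1..r. p j * (a j)\<^sup>2)"
    by (subst Bochner_Integration.integral_cong[OF refl score_square[OF assms]])
       (auto simp: expectation_score[OF assms])
  then show "variance (\<lambda>\<omega>. score a (X i \<omega>)) = multinomial_var r p a"
    using variance_eq[OF integrable_score[OF assms] i]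
    by (simp only: expectation_score[OF assms] multinomial_var_eq)
qed

text \<open>The sign is hidden by the subtracted cross terms but clear once the expression is the
  variance of the score of \<open>X 1\<close>.\<close>

lemma multinomial_var_nonneg: "multinomial_var r p a \<ge> 0"
  unfolding score_variance(2)[OF order_refl, symmetric] by simp

lemma indep_vars_score: "indep_vars (\<lambda>_. borel) (\<lambda>i \<omega>. score a (X (Suc i) \<omega>)) UNIV"
proof -
  \<comment> \<open>Samples are indexed from 1, the central limit theorem from 0. The disjoint
    blocks \<open>{Suc i}\<close> perform this shift while keeping independence.\<close>
  have "indep_vars (\<lambda>i. PiM {Suc i} (\<lambda>_. count_space (c ` {1..r}))) (\<lambda>i \<omega>. restrict (\<lambda>j. X j \<omega>) {Suc i}) UNIV"
    using iid unfolding iid_sample_def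
    by (intro indep_vars_restrict[where I="{1..}"]) (auto simp: disjoint_family_on_def)
  then have "indep_vars (\<lambda>_. borel) (\<lambda>i \<omega>. score a (restrict (\<lambda>j. X j \<omega>) {Suc i} (Suc i))) UNIV"
    by (rule indep_vars_compose2[where Y="\<lambda>i f. score a (f (Suc i))"])
       (auto intro!: measurable_compose[OF measurable_component_singleton])
  then show ?thesis by simp
qed

text \<open>\<open>iid_sample\<close> fixes only the point masses; on a finite alphabet these
  determine the law.\<close>

lemma distr_score:
  assumes "i \<ge> 1"
  shows "distr M borel (\<lambda>\<omega>. score a (X i \<omega>)) = distr M borel (\<lambda>\<omega>. score a (X 1 \<omega>))"
proof -
  let ?C = "count_space (c ` {1..r})"
  have eq: "distr M ?C (X i) = distr M ?C (X 1)"
  proof (rule measure_eqI_finite)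
    fix x assume x: "x \<in> c ` {1..r}"
    then obtain j where j: "j \<in> {1..r}" "x = c j" by auto
    have "emeasure (distr M ?C (X k)) {x} = p j" if "k \<ge> 1" for k
    proof -
      have "emeasure (distr M ?C (X k)) {x} = emeasure M {\<omega> \<in> space M. X k \<omega> = c j}"
        using j that sample_measurable[OF that]
        by (subst emeasure_distr) (auto simp: vimage_def Int_def conj_commute)
      then show ?thesis
        using iid j that unfolding iid_sample_def by (simp add: emeasure_eq_measure)
    qed
    then show "emeasure (distr M ?C (X i)) {x} = emeasure (distr M ?C (X 1)) {x}"
      using assms by simp
  qed auto
  have "distr M borel (\<lambda>\<omega>. score a (X k \<omega>)) = distr (distr M ?C (X k)) borel (score a)" if "k \<ge> 1" for k
    using sample_measurable[OF that] by (subst distr_distr) (auto simp: comp_def)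
  with assms eq show ?thesis by simp
qed

text \<open>Exchanging the sums over observations and over letters exhibits a normalised sum of
  centred iid scores. For \<open>n = 0\<close> both sides are 0.\<close>

lemma linear_stat_eq_sum:
  "linear_stat r c p a X n \<omega> = (\<Sum>i<n. score a (X (Suc i) \<omega>) - (\<Sum>j=1..r. p j * a j)) / sqrt (real n)"
proof (cases "n = 0")
  case False
  have "(\<Sum>i<n. score a (X (Suc i) \<omega>)) = (\<Sum>i=1..n. score a (X i \<omega>))"
    by (rule sum.reindex_bij_witness[of _ "\<lambda>i. i - 1" Suc]) auto
  also have "\<dots> = (\<Sum>j=1..r. \<Sum>i=1..n. a j * of_bool (X i \<omega> = c j))"
    unfolding score_def by (rule sum.swap)
  also have "\<dots> = (\<Sum>j=1..r. a j * (real n * empirical c X n \<omega> j))"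
    using False by (intro sum.cong refl) (simp only: sum_distrib_left[symmetric], simp add: empirical_def)
  finally have *: "(\<Sum>i<n. score a (X (Suc i) \<omega>) - (\<Sum>j=1..r. p j * a j)) =
      real n * (\<Sum>j=1..r. a j * (empirical c X n \<omega> j - p j))"
    by (simp add: sum_subtractf sum_distrib_left algebra_simps)
  have "linear_stat r c p a X n \<omega> = sqrt (real n) * (\<Sum>j=1..r. a j * (empirical c X n \<omega> j - p j))"
    by (simp add: linear_stat_def sum_distrib_left mult_ac)
  then show ?thesis
    unfolding * using False by (simp add: field_simps)
qed (simp add: linear_stat_def)

text \<open>Independence and centring kill the cross terms, so the sum has second moment
  \<open>n\<close> times the variance. After division by \<open>n\<close> this is the variance
  itself, except that it is 0 for \<open>n = 0\<close>; hence the inequality.\<close>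

lemma second_moment_linear_stat:
  "integrable M (\<lambda>\<omega>. (linear_stat r c p a X n \<omega>)\<^sup>2)"
  "expectation (\<lambda>\<omega>. (linear_stat r c p a X n \<omega>)\<^sup>2) \<le> multinomial_var r p a"
proof -
  define m where "m = (\<Sum>j=1..r. p j * a j)"
  define \<xi> where "\<xi> i \<omega> = score a (X (Suc i) \<omega>) - m" for i \<omega>
  let ?V = "multinomial_var r p a"
  have indep: "indep_vars (\<lambda>_. borel) \<xi> UNIV"
    unfolding \<xi>_def by (rule indep_vars_compose2[OF indep_vars_score]) auto
  have int\<xi>: "integrable M (\<xi> i)" and E\<xi>: "expectation (\<xi> i) = 0" for i
    unfolding \<xi>_def m_def
    by (auto simp: integrable_score expectation_score prob_space)
  have sq: "integrable M (\<lambda>\<omega>. (\<xi> i \<omega>)\<^sup>2)" "expectation (\<lambda>\<omega>. (\<xi> i \<omega>)\<^sup>2) = ?V" for i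
    using score_variance[of "Suc i" a] integrable_score[of "Suc i" a] unfolding \<xi>_def m_def
    by (auto simp: expectation_score power2_diff)
  define S where "S n \<omega> = (\<Sum>i<n. \<xi> i \<omega>)" for n \<omega>
  have S: "integrable M (\<lambda>\<omega>. (S n \<omega>)\<^sup>2) \<and> expectation (\<lambda>\<omega>. (S n \<omega>)\<^sup>2) = real n * ?V" for n
  proof (induction n)
    case 0
    then show ?case by (simp add: S_def)
  next
    case (Suc n)
    have ind: "indep_var borel (\<xi> n) borel (S n)"
      unfolding S_def by (rule indep_vars_sum) (auto intro: indep_vars_subset[OF indep])
    have intS: "integrable M (S n)" and ES: "expectation (S n) = 0"
      unfolding S_def by (auto simp: int\<xi> E\<xi> Bochner_Integration.integral_sum)
    have prod: "integrable M (\<lambda>\<omega>. \<xi> n \<omega> * S n \<omega>)" "expectation (\<lambda>\<omega>. \<xi> n \<omega> * S n \<omega>) = 0"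
      using indep_var_integrable[OF ind int\<xi> intS] indep_var_lebesgue_integral[OF ind int\<xi> intS]
      by (auto simp: ES)
    have "(S (Suc n) \<omega>)\<^sup>2 = (\<xi> n \<omega>)\<^sup>2 + (2 * (\<xi> n \<omega> * S n \<omega>) + (S n \<omega>)\<^sup>2)" for \<omega>
      by (simp add: S_def power2_eq_square algebra_simps)
    with Suc prod sq[of n] show ?case by (simp add: algebra_simps)
  qed
  have eq: "(linear_stat r c p a X n \<omega>)\<^sup>2 = (S n \<omega>)\<^sup>2 / real n" for \<omega>
    by (simp add: linear_stat_eq_sum S_def \<xi>_def m_def power_divide)
  show "integrable M (\<lambda>\<omega>. (linear_stat r c p a X n \<omega>)\<^sup>2)"
    "expectation (\<lambda>\<omega>. (linear_stat r c p a X n \<omega>)\<^sup>2) \<le> multinomial_var r p a"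
    using S[of n] multinomial_var_nonneg[of a] by (auto simp: eq)
qed

text \<open>The moment bound is uniform in the sample size, so any sequence \<open>N\<close> of
  sizes is allowed.\<close>

lemma bounded_in_prob_linear_stat: "bounded_in_prob M (\<lambda>n. linear_stat r c p a X (N n))"
  by (rule bounded_in_prob_second_moment[where C="multinomial_var r p a"])
     (auto simp: second_moment_linear_stat)

text \<open>One coordinate is the linear statistic whose coefficients form the \<open>j\<close>-th
  unit vector.\<close>

lemma bounded_in_prob_empirical:
  assumes "j \<in> {1..r}"
  shows "bounded_in_prob M (\<lambda>n \<omega>. sqrt (real (N n)) * (empirical c X (N n) \<omega> j - p j))"
proof -
  have "linear_stat r c p (\<lambda>i. of_bool (i = j)) X n \<omega> =
      sqrt (real n) * (empirical c X n \<omega> j - p j)" for n \<omega>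
    using assms by (simp add: linear_stat_def of_bool_def if_distrib[of "\<lambda>x. x * _"] cong: if_cong)
  then have "(\<lambda>n. linear_stat r c p (\<lambda>i. of_bool (i = j)) X (N n)) =
      (\<lambda>n \<omega>. sqrt (real (N n)) * (empirical c X (N n) \<omega> j - p j))"
    by (intro ext)
  then show ?thesis
    using bounded_in_prob_linear_stat[of "\<lambda>i. of_bool (i = j)" N] by metis
qed

text \<open>The central limit theorem divides by the standard deviation, so variance 0 is treated
  apart: the second moment is then 0 and the statistic vanishes almost surely.\<close>

lemma char_linear_stat_tendsto:
  "(\<lambda>n. char (distr M borel (linear_stat r c p a X n)) t)
     \<longlonglongrightarrow> complex_of_real (exp (- (multinomial_var r p a * t\<^sup>2) / 2))"
proof (cases "multinomial_var r p a = 0")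
  case True
  have "char (distr M borel (linear_stat r c p a X n)) t = 1" for n
  proof -
    have "expectation (\<lambda>\<omega>. (linear_stat r c p a X n \<omega>)\<^sup>2) = 0"
      using second_moment_linear_stat(2)[of a n] True by (intro antisym) auto
    then have "AE \<omega> in M. linear_stat r c p a X n \<omega> = 0"
      using integral_nonneg_eq_0_iff_AE[OF second_moment_linear_stat(1)[of a n]] by simp
    then have "(CLINT \<omega>|M. iexp (t * linear_stat r c p a X n \<omega>)) = (CLINT \<omega>|M. 1)"
      by (intro integral_cong_AE) auto
    then show ?thesis
      by (simp add: char_def integral_distr prob_space)
  qed
  then show ?thesis using True by simp
next
  case False
  define \<sigma> where "\<sigma> = sqrt (multinomial_var r p a)"
  have \<sigma>: "\<sigma> > 0" "\<sigma>\<^sup>2 = multinomial_var r p a"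
    using False multinomial_var_nonneg[of a] by (auto simp: \<sigma>_def)
  let ?m = "\<Sum>j=1..r. p j * a j"
  let ?Z = "\<lambda>n \<omega>. (\<Sum>i<n. score a (X (Suc i) \<omega>) - ?m) / sqrt (real n * \<sigma>\<^sup>2)"
  have "weak_conv_m (\<lambda>n. distr M borel (?Z n)) std_normal_distribution"
  proof (rule central_limit_theorem[OF indep_vars_score])
    show "distr M borel (\<lambda>\<omega>. score a (X (Suc n) \<omega>)) = distr M borel (\<lambda>\<omega>. score a (X 1 \<omega>))" for n
      by (rule distr_score) simp
    show "variance (\<lambda>\<omega>. score a (X (Suc n) \<omega>)) = \<sigma>\<^sup>2" for n
      unfolding \<sigma>(2) by (rule score_variance) simp
  qed (use \<sigma>(1) in \<open>simp_all add: expectation_score score_variance(1)\<close>)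
  moreover have meas: "?Z n \<in> borel_measurable M" for n
    using score_measurable[of "Suc _" a] by auto
  \<comment> \<open>\<open>?Z\<close> is standardised, and the statistic is \<open>\<sigma>\<close>
    times it; this factor moves into the argument of the characteristic function.\<close>
  ultimately have "(\<lambda>n. char (distr M borel (?Z n)) (\<sigma> * t)) \<longlonglongrightarrow> char std_normal_distribution (\<sigma> * t)"
    by (intro levy_continuity1 real_dist_normal_dist real_distribution_distr)
  moreover have "linear_stat r c p a X n = (\<lambda>\<omega>. \<sigma> * ?Z n \<omega>)" for n
    using \<sigma>(1) by (auto simp: linear_stat_eq_sum real_sqrt_mult)
  then have "char (distr M borel (linear_stat r c p a X n)) t = char (distr M borel (?Z n)) (\<sigma> * t)" for n
    by (simp only: char_distr_scale[OF meas])
  ultimately show ?thesis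
    by (simp add: char_std_normal_distribution power_mult_distrib \<sigma>(2))
qed

end

subsection \<open>The divergence statistic\<close>

context prob_space
begin

text \<open>The delta method at a common rate \<open>s\<close>. A constant \<open>S\<close> or
  \<open>T\<close> gives a one-sample statement, two empirical distributions give the two-sample
  one. \<open>Z\<close> has to match the linear part only up to a term vanishing in
  probability.\<close>

lemma divergence_converges_in_law:
  fixes S T :: "nat \<Rightarrow> 'a \<Rightarrow> nat \<Rightarrow> real"
  assumes \<phi>: "(\<lambda>(s, t). \<phi> s t) \<in> borel_measurable (restrict_space borel ({0..1} \<times> {0..1}))"
      "continuous_second_partials \<phi>"
    and pq: "\<And>j. j \<in> {1..r} \<Longrightarrow> p j \<in> {0<..<1}" "\<And>j. j \<in> {1..r} \<Longrightarrow> q j \<in> {0<..<1}"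
    and s: "filterlim s at_top sequentially"
    and meas: "\<And>k j. j \<in> {1..r} \<Longrightarrow> (\<lambda>\<omega>. S k \<omega> j) \<in> borel_measurable M"
      "\<And>k j. j \<in> {1..r} \<Longrightarrow> (\<lambda>\<omega>. T k \<omega> j) \<in> borel_measurable M"
    and unit: "\<And>k j \<omega>. j \<in> {1..r} \<Longrightarrow> S k \<omega> j \<in> {0..1}" "\<And>k j \<omega>. j \<in> {1..r} \<Longrightarrow> T k \<omega> j \<in> {0..1}"
    and bdd: "\<And>j. j \<in> {1..r} \<Longrightarrow> bounded_in_prob M (\<lambda>k \<omega>. s k * (S k \<omega> j - p j))"
      "\<And>j. j \<in> {1..r} \<Longrightarrow> bounded_in_prob M (\<lambda>k \<omega>. s k * (T k \<omega> j - q j))"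
    and L: "real_distribution L"
    and Z [measurable]: "\<And>k. Z k \<in> borel_measurable M"
    and lim: "\<And>t. (\<lambda>k. char (distr M borel (Z k)) t) \<longlonglongrightarrow> char L t"
    and van: "vanishes_in_prob M (\<lambda>k \<omega>.
      (\<Sum>j=1..r. partial1 \<phi> (p j) (q j) * (s k * (S k \<omega> j - p j))) +
      (\<Sum>j=1..r. partial2 \<phi> (p j) (q j) * (s k * (T k \<omega> j - q j))) - Z k \<omega>)"
      (is "vanishes_in_prob M ?W")
  shows "converges_in_law M
    (\<lambda>k \<omega>. s k * (phi_divergence r \<phi> (S k \<omega>) (T k \<omega>) - phi_divergence r \<phi> p q)) L"
proof -
  let ?D = "\<lambda>j (x, y). partial1 \<phi> (p j) (q j) * x + partial2 \<phi> (p j) (q j) * y"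
  define R where "R j k \<omega> = s k *
    (\<phi> (S k \<omega> j) (T k \<omega> j) - \<phi> (p j) (q j) - ?D j (S k \<omega> j - p j, T k \<omega> j - q j))" for j k \<omega>
  have R_meas: "R j k \<in> borel_measurable M" if j: "j \<in> {1..r}" for j k
  proof -
    note [measurable] = meas[OF j]
    \<comment> \<open>Measurability of \<open>\<phi>\<close> is known on the closed square only, so
      the pair is viewed as a map into that square.\<close>
    have "(\<lambda>\<omega>. (S k \<omega> j, T k \<omega> j)) \<in> measurable M (restrict_space borel ({0..1} \<times> {0..1}))"
      using unit[OF j] by (intro measurable_restrict_space2) auto
    from measurable_compose[OF this \<phi>(1)]
    have [measurable]: "(\<lambda>\<omega>. \<phi> (S k \<omega> j) (T k \<omega> j)) \<in> borel_measurable M" by simp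
    show ?thesis unfolding R_def by measurable
  qed
  have R_van: "vanishes_in_prob M (R j)" if j: "j \<in> {1..r}" for j
  proof -
    note [measurable] = meas[OF j]
    have "bounded_in_prob M (\<lambda>k \<omega>. (s k * (S k \<omega> j - p j), s k * (T k \<omega> j - q j)))"
      by (intro bounded_in_prob_Pair bdd j) measurable
    then have "bounded_in_prob M (\<lambda>k \<omega>. s k *\<^sub>R ((S k \<omega> j, T k \<omega> j) - (p j, q j)))"
      by simp
    from vanishes_in_prob_remainder
        [OF has_derivative_of_continuous_second_partials[OF \<phi>(2) pq(1)[OF j] pq(2)[OF j]] s _ this]
    show ?thesis by (simp add: R_def[abs_def])
  qed
  have W_meas: "?W k \<in> borel_measurable M" for k
    using meas by (intro borel_measurable_diff borel_measurable_add borel_measurable_sum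
        borel_measurable_times borel_measurable_const Z)
  \<comment> \<open>The statistic is \<open>Z\<close> plus the first-order remainders plus the
    difference between the linear part and \<open>Z\<close>; the last two vanish in
    probability.\<close>
  have "converges_in_law M (\<lambda>k \<omega>. Z k \<omega> + ((\<Sum>j=1..r. R j k \<omega>) + ?W k \<omega>)) L"
    by (intro converges_in_law_slutsky L lim vanishes_in_prob_add vanishes_in_prob_sum van
        borel_measurable_add borel_measurable_sum R_meas R_van W_meas Z finite_atLeastAtMost)
  moreover have "Z k \<omega> + ((\<Sum>j=1..r. R j k \<omega>) + ?W k \<omega>) =
      s k * (phi_divergence r \<phi> (S k \<omega>) (T k \<omega>) - phi_divergence r \<phi> p q)" for k \<omega>
    by (simp add: R_def phi_divergence_def sum_subtractf sum.distrib sum_distrib_left algebra_simps)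
  ultimately show ?thesis by (simp only:)
qed

lemma bounded_in_prob_zero: "bounded_in_prob M (\<lambda>k \<omega>. 0)"
  by (auto simp: bounded_in_prob_def intro!: exI[of _ 1])

lemma vanishes_in_prob_zero: "vanishes_in_prob M (\<lambda>k \<omega>. 0)"
  by (auto simp: vanishes_in_prob_def)

end

text \<open>A second letter of positive mass keeps \<open>p j\<close> below 1. The points
  \<open>(p j, q j)\<close> thus lie in the open square, where the derivatives are
  controlled.\<close>

lemma prob_vector_in_unit_interval:
  assumes "prob_vector r p" "\<forall>j\<in>{1..r}. p j > 0" "r \<ge> 2" "j \<in> {1..r}"
  shows "p j \<in> {0<..<1}"
proof -
  obtain i where i: "i \<in> {1..r}" "i \<noteq> j"
    using assms(3) by (metis atLeastAtMost_iff le_trans one_le_numeral order_refl numeral_eq_one_iff semiring_norm(83))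
  have "p i + p j = sum p {i, j}" using i by simp
  also have "\<dots> \<le> sum p {1..r}"
    using assms i by (intro sum_mono2) (auto intro: less_imp_le)
  also have "\<dots> = 1" using assms(1) by (simp add: prob_vector_def)
  finally show ?thesis using assms i by force
qed

section \<open>Asymptotics of the two sample sizes\<close>

text \<open>The other alternative of \<open>balanced_sizes\<close> is impossible, since the reciprocal of
  \<open>N K / (N + K)\<close> is \<open>1 / N + 1 / K\<close> and tends to \<open>0\<close>.\<close>

lemma balanced_sizes_proportion:
  assumes N: "filterlim N at_top sequentially" and K: "filterlim K at_top sequentially"
    and bal: "balanced_sizes N K \<gamma>" and \<gamma>: "\<gamma> > 0"
  shows "(\<lambda>k. real (N k) / (real (N k) + real (K k))) \<longlonglongrightarrow> \<gamma>"
proof -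
  have "\<not> (\<lambda>k. real (N k) * real (K k) / (real (N k) + real (K k))) \<longlonglongrightarrow> \<gamma>"
  proof
    assume "(\<lambda>k. real (N k) * real (K k) / (real (N k) + real (K k))) \<longlonglongrightarrow> \<gamma>"
    from tendsto_inverse[OF this] \<gamma>
    have 1: "(\<lambda>k. inverse (real (N k) * real (K k) / (real (N k) + real (K k)))) \<longlonglongrightarrow> inverse \<gamma>"
      by simp
    have inv: "(\<lambda>k. inverse (real (F k))) \<longlonglongrightarrow> 0" if "filterlim F at_top sequentially" for F
      using filterlim_compose[OF filterlim_real_sequentially that] tendsto_inverse_0_at_top by blast
    have "(\<lambda>k. inverse (real (N k)) + inverse (real (K k))) \<longlonglongrightarrow> 0"
      using tendsto_add[OF inv[OF N] inv[OF K]] by simp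
    moreover have "\<forall>\<^sub>F k in sequentially. inverse (real (N k)) + inverse (real (K k)) =
        inverse (real (N k) * real (K k) / (real (N k) + real (K k)))"
      using eventually_compose_filterlim[OF eventually_gt_at_top[of 0] N]
        eventually_compose_filterlim[OF eventually_gt_at_top[of 0] K]
      by eventually_elim (simp add: field_simps)
    ultimately have "(\<lambda>k. inverse (real (N k) * real (K k) / (real (N k) + real (K k)))) \<longlonglongrightarrow> 0"
      by (rule Lim_transform_eventually)
    from LIMSEQ_unique[OF 1 this] \<gamma> show False by simp
  qed
  with bal show ?thesis by (simp add: balanced_sizes_def)
qed

text \<open>Dividing numerator and denominator by \<open>N k + K k\<close> makes each quotient a
  continuous function of the proportion \<open>N k / (N k + K k)\<close>. The quotients are the
  squared weights of the two linear statistics in the two-sample case.\<close>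

lemma sample_weights_tendsto:
  assumes N: "filterlim N at_top sequentially"
    and ratio: "(\<lambda>k. real (N k) / (real (N k) + real (K k))) \<longlonglongrightarrow> \<gamma>"
    and D: "(1 - \<gamma>) * v + \<gamma> * w \<noteq> 0"
  shows "(\<lambda>k. real (K k) / (real (K k) * v + real (N k) * w)) \<longlonglongrightarrow> (1 - \<gamma>) / ((1 - \<gamma>) * v + \<gamma> * w)"
    and "(\<lambda>k. real (N k) / (real (K k) * v + real (N k) * w)) \<longlonglongrightarrow> \<gamma> / ((1 - \<gamma>) * v + \<gamma> * w)"
proof -
  let ?x = "\<lambda>k. real (N k) / (real (N k) + real (K k))"
  have pos: "\<forall>\<^sub>F k in sequentially. N k > 0"
    using N by (rule eventually_compose_filterlim[OF eventually_gt_at_top])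
  have "(\<lambda>k. (1 - ?x k) / ((1 - ?x k) * v + ?x k * w)) \<longlonglongrightarrow> (1 - \<gamma>) / ((1 - \<gamma>) * v + \<gamma> * w)"
    by (intro tendsto_intros ratio D)
  moreover have "\<forall>\<^sub>F k in sequentially. (1 - ?x k) / ((1 - ?x k) * v + ?x k * w) =
      real (K k) / (real (K k) * v + real (N k) * w)"
    using pos
  proof eventually_elim
    case (elim k)
    then have "1 - ?x k = real (K k) / (real (N k) + real (K k))" by (simp add: field_simps)
    with elim show ?case by (simp add: add_divide_distrib[symmetric])
  qed
  ultimately show "(\<lambda>k. real (K k) / (real (K k) * v + real (N k) * w)) \<longlonglongrightarrow>
      (1 - \<gamma>) / ((1 - \<gamma>) * v + \<gamma> * w)"
    by (rule Lim_transform_eventually)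
  have "(\<lambda>k. ?x k / ((1 - ?x k) * v + ?x k * w)) \<longlonglongrightarrow> \<gamma> / ((1 - \<gamma>) * v + \<gamma> * w)"
    by (intro tendsto_intros ratio D)
  moreover have "\<forall>\<^sub>F k in sequentially. ?x k / ((1 - ?x k) * v + ?x k * w) =
      real (N k) / (real (K k) * v + real (N k) * w)"
    using pos
  proof eventually_elim
    case (elim k)
    then have "1 - ?x k = real (K k) / (real (N k) + real (K k))" by (simp add: field_simps)
    with elim show ?case by (simp add: add_divide_distrib[symmetric])
  qed
  ultimately show "(\<lambda>k. real (N k) / (real (K k) * v + real (N k) * w)) \<longlonglongrightarrow>
      \<gamma> / ((1 - \<gamma>) * v + \<gamma> * w)"
    by (rule Lim_transform_eventually)
qed

section \<open>One-sample and two-sample limit laws of the divergence\<close>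

lemma filterlim_sqrt_real_at_top: "filterlim (\<lambda>n. sqrt (real n)) at_top sequentially"
  by (rule filterlim_compose[OF sqrt_at_top filterlim_real_sequentially])

theorem theorem2:
  fixes M :: "'w measure" and r :: nat and c :: "nat \<Rightarrow> 'a"
    and p q :: "nat \<Rightarrow> real" and \<phi> :: "real \<Rightarrow> real \<Rightarrow> real"
    and X Y :: "nat \<Rightarrow> 'w \<Rightarrow> 'a"
  assumes "prob_space M"
    and "r \<ge> 2" and "inj_on c {1..r}"
    and "prob_vector r p" and "\<forall>j\<in>{1..r}. p j > 0"
    and "prob_vector r q" and "\<forall>j\<in>{1..r}. q j > 0"
    and "iid_sample M r c p X" and "iid_sample M r c q Y"
    and "independent_samples M (c ` {1..r}) X Y"
    and "(\<lambda>(s, t). \<phi> s t) \<in> borel_measurable (restrict_space borel ({0..1} \<times> {0..1}))"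
    and "continuous_second_partials \<phi>"
  shows "converges_in_law M
           (\<lambda>n \<omega>. sqrt (real n) *
              (phi_divergence r \<phi> (empirical c X n \<omega>) q - phi_divergence r \<phi> p q))
           (normal_law 0 (V1 r \<phi> p q)) \<and>
         converges_in_law M
           (\<lambda>m \<omega>. sqrt (real m) *
              (phi_divergence r \<phi> p (empirical c Y m \<omega>) - phi_divergence r \<phi> p q))
           (normal_law 0 (V2 r \<phi> p q)) \<and>
         (\<forall>(N :: nat \<Rightarrow> nat) (K :: nat \<Rightarrow> nat) (\<gamma> :: real).
           filterlim N at_top sequentially \<longrightarrow> filterlim K at_top sequentially \<longrightarrow>
           0 < \<gamma> \<longrightarrow> \<gamma> < 1 \<longrightarrow> balanced_sizes N K \<gamma> \<longrightarrow>
           V1 r \<phi> p q \<noteq> 0 \<or> V2 r \<phi> p q \<noteq> 0 \<longrightarrow>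
           converges_in_law M
             (\<lambda>k \<omega>. sqrt (real (N k) * real (K k)
                 / (real (K k) * V1 r \<phi> p q + real (N k) * V2 r \<phi> p q)) *
                (phi_divergence r \<phi> (empirical c X (N k) \<omega>) (empirical c Y (K k) \<omega>)
                 - phi_divergence r \<phi> p q))
             (normal_law 0 1))"
proof -
  interpret prob_space M by fact
  interpret X: iid_sample_space M r c p X
    by unfold_locales (use assms in auto)
  interpret Y: iid_sample_space M r c q Y
    by unfold_locales (use assms in auto)
  define a where "a j = partial1 \<phi> (p j) (q j)" for j
  define b where "b j = partial2 \<phi> (p j) (q j)" for j
  let ?A = "linear_stat r c p a X" and ?B = "linear_stat r c q b Y"
  have V: "V1 r \<phi> p q = multinomial_var r p a" "V2 r \<phi> p q = multinomial_var r q b"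
    by (simp_all add: V1_def V2_def a_def[abs_def] b_def[abs_def])
  have V_nonneg: "V1 r \<phi> p q \<ge> 0" "V2 r \<phi> p q \<ge> 0"
    by (simp_all add: V X.multinomial_var_nonneg Y.multinomial_var_nonneg)
  have pq: "p j \<in> {0<..<1}" "q j \<in> {0<..<1}" if "j \<in> {1..r}" for j
    using prob_vector_in_unit_interval assms that by blast+
  have pq_le: "p j \<in> {0..1}" "q j \<in> {0..1}" if "j \<in> {1..r}" for j
    using pq[OF that] by auto

  have 1: "converges_in_law M
      (\<lambda>n \<omega>. sqrt (real n) *
        (phi_divergence r \<phi> (empirical c X n \<omega>) q - phi_divergence r \<phi> p q))
      (normal_law 0 (V1 r \<phi> p q))"
  \<comment> \<open>The second argument stays at \<open>q\<close>, so its deviations are 0 and the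
    linear part is exactly \<open>?A\<close>.\<close>
  proof (rule divergence_converges_in_law[where Z = ?A])
    show "vanishes_in_prob M (\<lambda>n \<omega>.
       (\<Sum>j=1..r. partial1 \<phi> (p j) (q j) * (sqrt (real n) * (empirical c X n \<omega> j - p j))) +
       (\<Sum>j=1..r. partial2 \<phi> (p j) (q j) * (sqrt (real n) * (q j - q j))) - ?A n \<omega>)"
      by (simp add: linear_stat_def a_def vanishes_in_prob_zero)
    show "bounded_in_prob M (\<lambda>n \<omega>. sqrt (real n) * (q j - q j))" for j
      by (simp add: bounded_in_prob_zero)
    show "(\<lambda>n. char (distr M borel (?A n)) t) \<longlonglongrightarrow> char (normal_law 0 (V1 r \<phi> p q)) t" for t
      unfolding V char_normal_law[OF X.multinomial_var_nonneg] by (rule X.char_linear_stat_tendsto)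
    show "bounded_in_prob M (\<lambda>n \<omega>. sqrt (real n) * (empirical c X n \<omega> j - p j))"
      if "j \<in> {1..r}" for j
      by (rule X.bounded_in_prob_empirical[OF that])
    show "empirical c X n \<omega> j \<in> {0..1}" for n \<omega> j
      by (simp add: empirical_bounds)
  qed (fact | rule borel_measurable_const filterlim_sqrt_real_at_top pq pq_le
      X.empirical_measurable X.linear_stat_measurable real_distribution_normal_law V_nonneg; assumption?)+

  have 2: "converges_in_law M
      (\<lambda>m \<omega>. sqrt (real m) *
        (phi_divergence r \<phi> p (empirical c Y m \<omega>) - phi_divergence r \<phi> p q))
      (normal_law 0 (V2 r \<phi> p q))"
  proof (rule divergence_converges_in_law[where Z = ?B])
    show "vanishes_in_prob M (\<lambda>n \<omega>.
       (\<Sum>j=1..r. partial1 \<phi> (p j) (q j) * (sqrt (real n) * (p j - p j))) +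
       (\<Sum>j=1..r. partial2 \<phi> (p j) (q j) * (sqrt (real n) * (empirical c Y n \<omega> j - q j))) - ?B n \<omega>)"
      by (simp add: linear_stat_def b_def vanishes_in_prob_zero)
    show "bounded_in_prob M (\<lambda>n \<omega>. sqrt (real n) * (p j - p j))" for j
      by (simp add: bounded_in_prob_zero)
    show "(\<lambda>n. char (distr M borel (?B n)) t) \<longlonglongrightarrow> char (normal_law 0 (V2 r \<phi> p q)) t" for t
      unfolding V char_normal_law[OF Y.multinomial_var_nonneg] by (rule Y.char_linear_stat_tendsto)
    show "bounded_in_prob M (\<lambda>n \<omega>. sqrt (real n) * (empirical c Y n \<omega> j - q j))"
      if "j \<in> {1..r}" for j
      by (rule Y.bounded_in_prob_empirical[OF that])
    show "empirical c Y n \<omega> j \<in> {0..1}" for n \<omega> j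
      by (simp add: empirical_bounds)
  qed (fact | rule borel_measurable_const filterlim_sqrt_real_at_top pq pq_le
      Y.empirical_measurable Y.linear_stat_measurable real_distribution_normal_law V_nonneg; assumption?)+

  have 3: "converges_in_law M
      (\<lambda>k \<omega>. sqrt (real (N k) * real (K k)
          / (real (K k) * V1 r \<phi> p q + real (N k) * V2 r \<phi> p q)) *
        (phi_divergence r \<phi> (empirical c X (N k) \<omega>) (empirical c Y (K k) \<omega>)
          - phi_divergence r \<phi> p q))
      (normal_law 0 1)"
    if N: "filterlim N at_top sequentially" and K: "filterlim K at_top sequentially"
      and \<gamma>: "0 < \<gamma>" "\<gamma> < 1" and bal: "balanced_sizes N K \<gamma>"
      and V_nz: "V1 r \<phi> p q \<noteq> 0 \<or> V2 r \<phi> p q \<noteq> 0"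
    for N K :: "nat \<Rightarrow> nat" and \<gamma> :: real
  proof -
    let ?v = "V1 r \<phi> p q" and ?w = "V2 r \<phi> p q"
    let ?D = "\<lambda>k. real (K k) * ?v + real (N k) * ?w"
    define D where "D = (1 - \<gamma>) * ?v + \<gamma> * ?w"
    \<comment> \<open>\<open>D\<close> is the limit of \<open>?D k / (N k + K k)\<close>. It is
      positive because one variance is nonzero and \<open>\<gamma>\<close> lies strictly between 0
      and 1.\<close>
    have "D > 0"
    proof (cases "?v = 0")
      case True
      with V_nz V_nonneg \<gamma> show ?thesis by (auto simp: D_def intro!: mult_pos_pos)
    next
      case False
      with V_nonneg \<gamma> show ?thesis unfolding D_def by (intro add_pos_nonneg mult_pos_pos) auto
    qed
    \<comment> \<open>The common rate \<open>s\<close> is \<open>\<alpha>\<close> times the natural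
      rate of the first sample and \<open>\<beta>\<close> times that of the second, so these are the
      weights of \<open>?A\<close> and \<open>?B\<close> in the linear part.\<close>
    define \<alpha> where "\<alpha> k = sqrt (real (K k) / ?D k)" for k
    define \<beta> where "\<beta> k = sqrt (real (N k) / ?D k)" for k
    define s where "s k = sqrt (real (N k) * real (K k) / ?D k)" for k
    define \<alpha>' where "\<alpha>' = sqrt ((1 - \<gamma>) / D)"
    define \<beta>' where "\<beta>' = sqrt (\<gamma> / D)"
    have s_eq: "s k = \<alpha> k * sqrt (real (N k))" "s k = \<beta> k * sqrt (real (K k))" for k
      by (simp_all add: s_def \<alpha>_def \<beta>_def real_sqrt_mult[symmetric] mult.commute)
    have lims: "\<alpha> \<longlonglongrightarrow> \<alpha>'" "\<beta> \<longlonglongrightarrow> \<beta>'"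
      using sample_weights_tendsto[OF N balanced_sizes_proportion[OF N K bal \<gamma>(1)], of ?v ?w] \<open>D > 0\<close>
      by (auto simp: \<alpha>_def[abs_def] \<beta>_def[abs_def] \<alpha>'_def \<beta>'_def D_def intro!: tendsto_real_sqrt)
    obtain C1 C2 where C: "\<And>k. \<bar>\<alpha> k\<bar> \<le> C1" "\<And>k. \<bar>\<beta> k\<bar> \<le> C2"
      using lims[THEN convergentI, THEN convergent_imp_Bseq] by (auto simp: Bseq_def)
    have "\<alpha>' > 0" using \<gamma> \<open>D > 0\<close> by (simp add: \<alpha>'_def)
    have s_top: "filterlim s at_top sequentially"
      unfolding s_eq(1)[abs_def]
      by (rule filterlim_tendsto_pos_mult_at_top[OF lims(1) \<open>\<alpha>' > 0\<close>])
         (rule filterlim_compose[OF filterlim_sqrt_real_at_top N])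
    \<comment> \<open>Limiting weights are used so that the characteristic functions of
      \<open>?A\<close> and \<open>?B\<close> are evaluated at arguments not depending on
      \<open>k\<close>.\<close>
    let ?Z = "\<lambda>k \<omega>. \<alpha>' * ?A (N k) \<omega> + \<beta>' * ?B (K k) \<omega>"
    have indep: "indep_var borel (\<lambda>\<omega>. \<alpha>' * ?A (N k) \<omega>) borel (\<lambda>\<omega>. \<beta>' * ?B (K k) \<omega>)" for k
    proof -
      \<comment> \<open>A linear statistic is a measurable functional of the whole sample path, with
        the coordinate maps in the role of the sample. Independence of the two paths therefore
        passes to the statistics.\<close>
      have g: "(\<lambda>x. z * linear_stat r c u d (\<lambda>i x. x i) n x)
          \<in> borel_measurable (Pi\<^sub>M {1..} (\<lambda>_. count_space (c ` {1..r})))" for z u d n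
        by (intro borel_measurable_times borel_measurable_const
            measurable_linear_stat[where A="c ` {1..r}"] measurable_component_singleton) auto
      have eq: "(\<lambda>x. z * linear_stat r c u d (\<lambda>i x. x i) n x) \<circ> (\<lambda>\<omega>. \<lambda>i\<in>{1..}. U i \<omega>) =
          (\<lambda>\<omega>. z * linear_stat r c u d U n \<omega>)" for U :: "nat \<Rightarrow> 'w \<Rightarrow> 'a" and z u d n
        by (simp add: fun_eq_iff linear_stat_def empirical_def del: sum_of_bool_eq)
      from assms(10) have "indep_var
          (Pi\<^sub>M {1..} (\<lambda>_. count_space (c ` {1..r}))) (\<lambda>\<omega>. \<lambda>i\<in>{1..}. X i \<omega>)
          (Pi\<^sub>M {1..} (\<lambda>_. count_space (c ` {1..r}))) (\<lambda>\<omega>. \<lambda>i\<in>{1..}. Y i \<omega>)"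
        by (simp add: independent_samples_def)
      from indep_var_compose[OF this g[of \<alpha>' p a "N k"] g[of \<beta>' q b "K k"]]
      show ?thesis unfolding eq .
    qed
    have "converges_in_law M
        (\<lambda>k \<omega>. s k * (phi_divergence r \<phi> (empirical c X (N k) \<omega>) (empirical c Y (K k) \<omega>)
          - phi_divergence r \<phi> p q)) (normal_law 0 1)"
    proof (rule divergence_converges_in_law[where Z = ?Z])
      have "vanishes_in_prob M (\<lambda>k \<omega>. (\<alpha> k - \<alpha>') * ?A (N k) \<omega> + (\<beta> k - \<beta>') * ?B (K k) \<omega>)"
        by (intro vanishes_in_prob_add vanishes_in_prob_coeff X.bounded_in_prob_linear_stat
            Y.bounded_in_prob_linear_stat LIM_zero lims) measurable
      also have "(\<lambda>k \<omega>. (\<alpha> k - \<alpha>') * ?A (N k) \<omega> + (\<beta> k - \<beta>') * ?B (K k) \<omega>) = (\<lambda>k \<omega>.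
         (\<Sum>j=1..r. partial1 \<phi> (p j) (q j) * (s k * (empirical c X (N k) \<omega> j - p j))) +
         (\<Sum>j=1..r. partial2 \<phi> (p j) (q j) * (s k * (empirical c Y (K k) \<omega> j - q j))) - ?Z k \<omega>)"
      proof (intro ext)
        fix k \<omega>
        have "(\<Sum>j=1..r. partial1 \<phi> (p j) (q j) * (s k * (empirical c X (N k) \<omega> j - p j))) =
            \<alpha> k * ?A (N k) \<omega>"
          unfolding s_eq(1) by (simp add: linear_stat_def a_def sum_distrib_left mult_ac)
        moreover have "(\<Sum>j=1..r. partial2 \<phi> (p j) (q j) * (s k * (empirical c Y (K k) \<omega> j - q j))) =
            \<beta> k * ?B (K k) \<omega>"
          unfolding s_eq(2) by (simp add: linear_stat_def b_def sum_distrib_left mult_ac)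
        ultimately show "(\<alpha> k - \<alpha>') * ?A (N k) \<omega> + (\<beta> k - \<beta>') * ?B (K k) \<omega> =
          (\<Sum>j=1..r. partial1 \<phi> (p j) (q j) * (s k * (empirical c X (N k) \<omega> j - p j))) +
          (\<Sum>j=1..r. partial2 \<phi> (p j) (q j) * (s k * (empirical c Y (K k) \<omega> j - q j))) - ?Z k \<omega>"
          by (simp add: algebra_simps)
      qed
      finally show "vanishes_in_prob M (\<lambda>k \<omega>.
         (\<Sum>j=1..r. partial1 \<phi> (p j) (q j) * (s k * (empirical c X (N k) \<omega> j - p j))) +
         (\<Sum>j=1..r. partial2 \<phi> (p j) (q j) * (s k * (empirical c Y (K k) \<omega> j - q j))) - ?Z k \<omega>)" .
      show "bounded_in_prob M (\<lambda>k \<omega>. s k * (empirical c X (N k) \<omega> j - p j))" if "j \<in> {1..r}" for j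
        unfolding s_eq(1) mult.assoc
        by (intro bounded_in_prob_const_mult[OF _ C(1)] X.bounded_in_prob_empirical that) measurable
      show "bounded_in_prob M (\<lambda>k \<omega>. s k * (empirical c Y (K k) \<omega> j - q j))" if "j \<in> {1..r}" for j
        unfolding s_eq(2) mult.assoc
        by (intro bounded_in_prob_const_mult[OF _ C(2)] Y.bounded_in_prob_empirical that) measurable
      show "(\<lambda>k. char (distr M borel (?Z k)) t) \<longlonglongrightarrow> char (normal_law 0 1) t" for t
      proof -
        \<comment> \<open>By independence this product is the characteristic function of
          \<open>?Z k\<close>.\<close>
        have "(\<lambda>k. char (distr M borel (?A (N k))) (\<alpha>' * t) * char (distr M borel (?B (K k))) (\<beta>' * t))
          \<longlonglongrightarrow> complex_of_real (exp (- (?v * (\<alpha>' * t)\<^sup>2) / 2)) * complex_of_real (exp (- (?w * (\<beta>' * t)\<^sup>2) / 2))"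
          unfolding V
          by (intro tendsto_mult filterlim_compose[OF X.char_linear_stat_tendsto N]
              filterlim_compose[OF Y.char_linear_stat_tendsto K])
        also have "complex_of_real (exp (- (?v * (\<alpha>' * t)\<^sup>2) / 2)) *
            complex_of_real (exp (- (?w * (\<beta>' * t)\<^sup>2) / 2)) = char (normal_law 0 1) t"
        proof -
          \<comment> \<open>The limiting variance of \<open>?Z\<close>: the squared weights are
            \<open>(1 - \<gamma>) / D\<close> and \<open>\<gamma> / D\<close>, and \<open>D\<close>
            is the matching combination of the variances.\<close>
          have "?v * \<alpha>'\<^sup>2 + ?w * \<beta>'\<^sup>2 = D / D"
            using \<gamma> \<open>D > 0\<close> by (simp add: \<alpha>'_def \<beta>'_def add_divide_distrib[symmetric])
               (simp add: D_def mult.commute)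
          then have one: "?v * \<alpha>'\<^sup>2 + ?w * \<beta>'\<^sup>2 = 1" using \<open>D > 0\<close> by simp
          have "?v * (\<alpha>' * t)\<^sup>2 + ?w * (\<beta>' * t)\<^sup>2 = (?v * \<alpha>'\<^sup>2 + ?w * \<beta>'\<^sup>2) * t\<^sup>2"
            by (simp add: power_mult_distrib algebra_simps)
          then have "- (?v * (\<alpha>' * t)\<^sup>2) / 2 + - (?w * (\<beta>' * t)\<^sup>2) / 2 = - (1 * t\<^sup>2) / 2"
            unfolding one by simp
          then show ?thesis
            unfolding of_real_mult[symmetric] exp_add[symmetric] by (simp only: char_normal_law zero_le_one)
        qed
        finally show ?thesis
          by (simp add: char_distr_add[OF indep] char_distr_scale)
      qed
      show "empirical c X n \<omega> j \<in> {0..1}" "empirical c Y n \<omega> j \<in> {0..1}" for n \<omega> j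
        by (simp_all add: empirical_bounds)
      show "real_distribution (normal_law 0 1)"
        by (simp add: real_distribution_normal_law)
      show "?Z k \<in> borel_measurable M" for k by measurable
    qed (fact | rule pq s_top X.empirical_measurable Y.empirical_measurable; assumption?)+
    then show ?thesis by (simp only: s_def)
  qed
  from 1 2 3 show ?thesis by blast
qed

end
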